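(* Let $n=3$ and let $z_1<z_2$ be the two positive zeros of $F$. The set of admissible values for twisted $(2,3)$-crowns is $$\mathcal{A}_2(3)=(0,z_1)\cup(1/z_2,z_2)\cup(1/z_1,\infty).$$ Furthermore, for every $m>0$ there exists an admissible value $a\in\mathcal{A}_2(3)$ with $H(a)=m$.
   Context: Let $n\ge 2$ be an integer. For $a>0$ and $m>0$ consider $2n$ bodies in the plane $\mathbb{R}^2\cong\mathbb{C}$: $n$ bodies of mass $1$ at the points $e^{2\pi i k/n}$, $k=0,\dots,n-1$, and $n$ bodies of mass $m$ at the points $a\,e^{i(\pi/n+2\pi k/n)}$, $k=0,\dots,n-1$. The center of mass is at the origin. Configuration $(q_i)$ with masses $(\mu_i)$ is a central configuration if there is $\lambda\in\mathbb{R}$ such that $\nabla_{q_i}U+\lambda\mu_i q_i=0$ for all $i$, where $U=\sum_{i<j}\mu_i\mu_j/\|q_i-q_j\|$. If the configuration of $2n$ bodies consisting of $n$ bodies of mass $1$ at the points $e^{2\pi i k/n}$ and $n$ bodies of mass $m$ at the points $a\,e^{i(\pi/n+2\pi k/n)}$, $k=0,\dots,n-1$, is central, it is called a twisted $(2,n)$-crown with radius $a$ and mass ratio $m$. A value $a>0$ is admissible if there exists $m>0$ such that the configuration with parameters $(a,m)$ is a twisted $(2,n)$-crown; $\mathcal{A}_2(n)$ denotes the set of admissible values. Put $S_n=\frac14\sum_{k=1}^{n-1}\frac{1}{\sin(k\pi/n)}$, $\theta_k=(2k-1)\pi/n$, and $$C_{12}(a)=\sum_{k=1}^n\frac{1-a\cos\theta_k}{(1+a^2-2a\cos\theta_k)^{3/2}},\qquad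 C_{21}(a)=\sum_{k=1}^n\frac{a-\cos\theta_k}{(1+a^2-2a\cos\theta_k)^{3/2}},$$ $$F(a)=S_na-C_{21}(a),\qquad G(a)=S_n-a^3C_{12}(a),\qquad H(a)=a^2\frac{F(a)}{G(a)}.$$ The configuration with parameters $(a,m)$ is a twisted $(2,n)$-crown if and only if $(C_{21}(a)-S_na)+\left(\frac{S_n}{a^2}-aC_{12}(a)\right)m=0$, that is, $m=H(a)$ when $G(a)\neq0$. For $n=3$ the equation $F(a)=0$ has exactly two positive solutions, denoted $z_1<z_2$; they satisfy $3/8<z_1<7/16$ and $25/16<z_2<13/8$. *)

theory Defs
  imports "HOL-Analysis.Analysis"
begin

definition potential :: "nat \<Rightarrow> (nat \<Rightarrow> real) \<Rightarrow> (nat \<Rightarrow> complex) \<Rightarrow> real" where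
  "potential N \<mu> q = (\<Sum>j<N. \<Sum>i<j. \<mu> i * \<mu> j / norm (q i - q j))"

text \<open>
  The partial gradient of the potential with respect to the position of body \<open>i\<close> is taken for
  the real inner product on the complex plane. Collisions are excluded explicitly, since the
  convention \<open>x / 0 = 0\<close> would otherwise give the potential a spurious finite value there.
\<close>

definition central_configuration :: "nat \<Rightarrow> (nat \<Rightarrow> real) \<Rightarrow> (nat \<Rightarrow> complex) \<Rightarrow> bool" where
  "central_configuration N \<mu> q \<longleftrightarrow>
     inj_on q {..<N} \<and>
     (\<exists>l::real. \<forall>i<N. \<exists>D. GDERIV (\<lambda>z. potential N \<mu> (q(i := z))) (q i) :> D
        \<and> D + (l * \<mu> i) *\<^sub>R q i = 0)"

text \<open>
  Indices \<open>0, \<dots>, n - 1\<close> label the bodies of mass \<open>1\<close> on the unit circle, and indices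
  \<open>n, \<dots>, 2 * n - 1\<close> the bodies of mass \<open>m\<close> on the circle of radius \<open>a\<close>.
\<close>

definition crown_position :: "nat \<Rightarrow> real \<Rightarrow> nat \<Rightarrow> complex" where
  "crown_position n a k =
     (if k < n then cis (2 * pi * real k / real n)
      else complex_of_real a * cis (pi / real n + 2 * pi * real (k - n) / real n))"

definition crown_mass :: "nat \<Rightarrow> real \<Rightarrow> nat \<Rightarrow> real" where
  "crown_mass n m k = (if k < n then 1 else m)"

definition twisted_crown :: "nat \<Rightarrow> real \<Rightarrow> real \<Rightarrow> bool" where
  "twisted_crown n a m \<longleftrightarrow> central_configuration (2 * n) (crown_mass n m) (crown_position n a)"

definition admissible_values :: "nat \<Rightarrow> real set" where
  "admissible_values n = {a. 0 < a \<and> (\<exists>m>0. twisted_crown n a m)}"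

definition crown_S :: "nat \<Rightarrow> real" where
  "crown_S n = 1 / 4 * (\<Sum>k=1..n-1. 1 / sin (real k * pi / real n))"

definition crown_theta :: "nat \<Rightarrow> nat \<Rightarrow> real" where
  "crown_theta n k = (2 * real k - 1) * pi / real n"

definition crown_C12 :: "nat \<Rightarrow> real \<Rightarrow> real" where
  "crown_C12 n a = (\<Sum>k=1..n. (1 - a * cos (crown_theta n k))
      / (1 + a\<^sup>2 - 2 * a * cos (crown_theta n k)) powr (3 / 2))"

definition crown_C21 :: "nat \<Rightarrow> real \<Rightarrow> real" where
  "crown_C21 n a = (\<Sum>k=1..n. (a - cos (crown_theta n k))
      / (1 + a\<^sup>2 - 2 * a * cos (crown_theta n k)) powr (3 / 2))"

definition crown_F :: "nat \<Rightarrow> real \<Rightarrow> real" where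
  "crown_F n a = crown_S n * a - crown_C21 n a"

definition crown_G :: "nat \<Rightarrow> real \<Rightarrow> real" where
  "crown_G n a = crown_S n - a ^ 3 * crown_C12 n a"

text \<open>
  Where \<open>crown_G n a = 0\<close> this quotient is \<open>0\<close> by convention, so \<open>crown_H n a = m\<close> with
  \<open>m > 0\<close> forces \<open>crown_G n a \<noteq> 0\<close>.
\<close>

definition crown_H :: "nat \<Rightarrow> real \<Rightarrow> real" where
  "crown_H n a = a\<^sup>2 * (crown_F n a / crown_G n a)"

end

theory Submission
  imports Defs
begin

text \<open>
  Dividing the gradient equation of a body by its mass turns it into a statement about the
  acceleration that the other bodies cause: a configuration is central iff the acceleration of
  every body is the same real multiple of its position (\<open>central_configuration_iff\<close>).
  A twisted crown is invariant under the rotation by \<open>2 * pi / n\<close> and under reflection in the line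
  through the origin and any one of its bodies. So the acceleration of every body is radial, and its
  factor is the same for all bodies of one ring (\<open>crown_total_attraction\<close>). Two factors remain, and
  their equality is the single equation \<open>m * G(a) = a\<^sup>2 * F(a)\<close> (\<open>twisted_crown_iff\<close>). Hence \<open>a\<close> is
  admissible iff \<open>F(a)\<close> and \<open>G(a)\<close> are both positive, both negative or both zero.

  Exchanging the roles of the two rings and rescaling gives \<open>G(a) = a * F(1/a)\<close>
  (\<open>crown_G_eq_F_inverse\<close>), so the signs of \<open>F\<close> determine those of \<open>G\<close>. For \<open>n = 3\<close> the function \<open>F\<close>
  is positive at \<open>1/4\<close>, negative at \<open>1/2\<close> and \<open>1\<close>, and positive at \<open>2\<close>. Since it has only the
  zeros \<open>z1 < z2\<close>, these satisfy \<open>1/4 < z1 < 1/2\<close> and \<open>1 < z2 < 2\<close>, and \<open>F\<close> is negative exactly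
  between them, while \<open>G\<close> is negative exactly between \<open>1/z2\<close> and \<open>1/z1\<close>. The bounds yield
  \<open>z1 * z2 < 1\<close>, which orders the four numbers as \<open>z1 < 1/z2 < z2 < 1/z1\<close>; in particular
  \<open>F\<close> and \<open>G\<close> have no common zero. Comparing signs gives the three intervals.

  The middle interval alone realises every mass ratio: \<open>H\<close> tends to infinity at \<open>1/z2\<close>, where \<open>G\<close>
  vanishes and \<open>F\<close> does not, and tends to zero at \<open>z2\<close>, where \<open>F\<close> vanishes and \<open>G\<close> does not.
  Applying the intermediate value theorem to \<open>a\<^sup>2 * F(a) - m * G(a)\<close> on the closed
  interval avoids both limits.
\<close>

section \<open>The gradient of the potential\<close>

text \<open>
  The acceleration that a unit mass displaced by \<open>z\<close> exerts. Because \<open>inverse 0 = 0\<close>, a body does not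
  act on itself, so sums over the other bodies can run over all bodies.
\<close>

definition attraction :: "complex \<Rightarrow> complex" where
  "attraction z = z /\<^sub>R norm z ^ 3"

lemma attraction_0 [simp]: "attraction 0 = 0"
  by (simp add: attraction_def)

lemma attraction_cis_mult: "attraction (cis t * z) = cis t * attraction z"
  by (simp add: attraction_def norm_mult)

lemma attraction_scaleR:
  assumes "0 < r"
  shows "attraction (r *\<^sub>R z) = attraction z /\<^sub>R r\<^sup>2"
  using assms by (simp add: attraction_def power_mult_distrib power2_eq_square power3_eq_cube)

lemma GDERIV_inverse_distance:
  fixes z w :: complex
  assumes "z \<noteq> w"
  shows "GDERIV (\<lambda>z. c / norm (z - w)) z :> c *\<^sub>R attraction (w - z)"
proof -
  have nz: "norm (z - w) \<noteq> 0" using assms by simp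
  have "((\<lambda>z. z - w) has_derivative (\<lambda>h. h)) (at z)"
    by (auto intro!: derivative_eq_intros)
  then have dist: "((\<lambda>z. norm (z - w)) has_derivative (\<lambda>h. inner h (sgn (z - w)))) (at z)"
    by (rule has_derivative_compose) (use assms in \<open>simp add: has_derivative_norm\<close>)
  have "((\<lambda>z. c / norm (z - w)) has_derivative
      (\<lambda>h. - c * inner h (sgn (z - w)) / (norm (z - w))\<^sup>2)) (at z)"
    using assms by (auto intro!: derivative_eq_intros dist simp: power2_eq_square field_simps)
  moreover have "- c * inner h (sgn (z - w)) / (norm (z - w))\<^sup>2
      = inner h (c *\<^sub>R attraction (w - z))" for h
  proof -
    have "w - z = - (z - w)" by simp
    then show ?thesis using nz
      by (simp only: attraction_def sgn_div_norm inner_scaleR_right inner_minus_right norm_minus_cancel)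
        (simp add: field_simps power2_eq_square power3_eq_cube)
  qed
  ultimately show ?thesis by (simp add: gderiv_def)
qed

lemma GDERIV_sum:
  assumes "\<And>j. j \<in> J \<Longrightarrow> GDERIV (f j) x :> D j"
  shows "GDERIV (\<lambda>z. \<Sum>j\<in>J. f j z) x :> (\<Sum>j\<in>J. D j)"
  using assms unfolding gderiv_def inner_sum_right by (intro has_derivative_sum)

lemma GDERIV_unique:
  assumes "GDERIV f x :> D" and "GDERIV f x :> E"
  shows "D = E"
proof -
  have "(\<lambda>h. inner h D) = (\<lambda>h. inner h E)"
    using assms unfolding gderiv_def by (rule has_derivative_unique)
  then have "inner (D - E) D = inner (D - E) E" by metis
  then have "inner (D - E) (D - E) = 0" by (simp add: inner_diff_right)
  then show ?thesis by simp
qed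

text \<open>
  Each pair of bodies containing body \<open>i\<close> contributes its attraction and every other pair is constant.
  The double sum runs over ordered pairs \<open>k < j\<close>, so the partners of \<open>i\<close> occur partly as first and
  partly as second component.
\<close>

lemma GDERIV_potential:
  assumes inj: "inj_on q {..<N}" and i: "i < N"
  shows "GDERIV (\<lambda>z. potential N \<mu> (q(i := z))) (q i) :>
    \<mu> i *\<^sub>R (\<Sum>j<N. \<mu> j *\<^sub>R attraction (q j - q i))"
proof -
  define g where "g j = (\<mu> i * \<mu> j) *\<^sub>R attraction (q j - q i)" for j
  have pair: "GDERIV (\<lambda>z. \<mu> k * \<mu> j / norm ((q(i := z)) k - (q(i := z)) j)) (q i)
      :> (if k = i then g j else 0) + (if j = i then g k else 0)"
    if "j < N" "k < j" for j k
  proof -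
    have ne: "q i \<noteq> q l" if "l < N" "l \<noteq> i" for l
      using inj i that by (auto dest: inj_onD)
    consider "k = i" "j \<noteq> i" | "j = i" "k \<noteq> i" | "k \<noteq> i" "j \<noteq> i"
      using \<open>k < j\<close> by fastforce
    then show ?thesis
    proof cases
      case 1
      then show ?thesis
        using GDERIV_inverse_distance[OF ne[of j], of "\<mu> i * \<mu> j"] that by (simp add: g_def)
    next
      case 2
      then show ?thesis
        using GDERIV_inverse_distance[OF ne[of k], of "\<mu> i * \<mu> k"] that
        by (simp add: g_def norm_minus_commute mult.commute)
    next
      case 3
      then show ?thesis by (simp add: GDERIV_const)
    qed
  qed
  have "(\<Sum>j<N. \<Sum>k<j. (if k = i then g j else 0) + (if j = i then g k else 0))
      = (\<Sum>j<N. if i < j then g j else 0) + (\<Sum>j<N. if j = i then \<Sum>k<i. g k else 0)"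
  proof -
    have "(\<Sum>k<j. if k = i then g j else 0) = (if i < j then g j else 0)"
      "(\<Sum>k<j. if j = i then g k else 0) = (if j = i then \<Sum>k<i. g k else 0)" for j
      by simp_all
    then show ?thesis by (simp only: sum.distrib)
  qed
  also have "\<dots> = (\<Sum>j\<in>{i<..<N}. g j) + (\<Sum>k<i. g k)"
  proof -
    have "{..<N} \<inter> {j. i < j} = {i<..<N}" by auto
    then show ?thesis using i by (simp add: sum.If_cases)
  qed
  also have "\<dots> = (\<Sum>j<N. g j)"
  proof -
    have "{..<N} = insert i ({i<..<N} \<union> {..<i})" using i by auto
    moreover have "{i<..<N} \<inter> {..<i} = {}" by auto
    moreover have "g i = 0" by (simp add: g_def)
    ultimately show ?thesis by (simp add: sum.union_disjoint)
  qed
  also have "\<dots> = \<mu> i *\<^sub>R (\<Sum>j<N. \<mu> j *\<^sub>R attraction (q j - q i))"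
    by (simp add: g_def scaleR_right.sum)
  finally have eq: "(\<Sum>j<N. \<Sum>k<j. (if k = i then g j else 0) + (if j = i then g k else 0))
      = \<mu> i *\<^sub>R (\<Sum>j<N. \<mu> j *\<^sub>R attraction (q j - q i))" .
  show ?thesis
    unfolding potential_def eq[symmetric] by (intro GDERIV_sum) (use pair in auto)
qed

lemma central_configuration_iff:
  assumes "\<And>i. i < N \<Longrightarrow> \<mu> i \<noteq> 0"
  shows "central_configuration N \<mu> q \<longleftrightarrow> inj_on q {..<N} \<and>
    (\<exists>l::real. \<forall>i<N. (\<Sum>j<N. \<mu> j *\<^sub>R attraction (q j - q i)) = - l *\<^sub>R q i)"
proof -
  have "(\<exists>D. GDERIV (\<lambda>z. potential N \<mu> (q(i := z))) (q i) :> D \<and> D + (l * \<mu> i) *\<^sub>R q i = 0)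
      \<longleftrightarrow> (\<Sum>j<N. \<mu> j *\<^sub>R attraction (q j - q i)) = - l *\<^sub>R q i"
    if "inj_on q {..<N}" "i < N" for i l
  proof -
    let ?A = "\<Sum>j<N. \<mu> j *\<^sub>R attraction (q j - q i)"
    have "(\<exists>D. GDERIV (\<lambda>z. potential N \<mu> (q(i := z))) (q i) :> D \<and> D + (l * \<mu> i) *\<^sub>R q i = 0)
        \<longleftrightarrow> \<mu> i *\<^sub>R ?A + (l * \<mu> i) *\<^sub>R q i = 0"
      using GDERIV_potential[OF that] GDERIV_unique by blast
    also have "\<dots> \<longleftrightarrow> \<mu> i *\<^sub>R (?A + l *\<^sub>R q i) = 0"
      by (simp add: scaleR_add_right mult.commute)
    also have "\<dots> \<longleftrightarrow> ?A = - l *\<^sub>R q i"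
      using assms[OF \<open>i < N\<close>] by (simp add: add_eq_0_iff2)
    finally show ?thesis .
  qed
  then show ?thesis
    unfolding central_configuration_def by (intro conj_cong ex_cong1 all_cong refl)
qed

section \<open>Attraction of regular polygons\<close>

lemma sum_periodic_shift:
  fixes g :: "nat \<Rightarrow> 'a::comm_monoid_add"
  assumes "\<And>k. g (k + n) = g k"
  shows "(\<Sum>k<n. g k) = (\<Sum>k<n. g (k + i))"
proof (induction i)
  case (Suc i)
  show ?case
  proof (cases n)
    case (Suc n')
    have "(\<Sum>k<n. g (k + i)) = g i + (\<Sum>k<n'. g (Suc k + i))"
      unfolding Suc sum.lessThan_Suc_shift by simp
    also have "g i = g (n' + Suc i)"
      using assms[of i] Suc by (simp add: add.commute)
    finally show ?thesis
      using Suc.IH by (simp add: \<open>n = Suc n'\<close> add.commute)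
  qed simp
qed simp

lemma cis_ring_period:
  assumes "0 < n"
  shows "cis (c + 2 * pi * real (k + n) / real n) = cis (c + 2 * pi * real k / real n)"
proof -
  have "c + 2 * pi * real (k + n) / real n = (c + 2 * pi * real k / real n) + 2 * pi"
    using assms by (simp add: field_simps)
  then show ?thesis by (simp only: complex_eq_iff cis.sel cos_periodic sin_periodic simp_thms)
qed

lemma square_powr_three_halves:
  fixes x :: real
  assumes "0 \<le> x"
  shows "x\<^sup>2 powr (3 / 2) = x ^ 3"
proof (cases "x = 0")
  case False
  with assms have "0 < x" by simp
  then show ?thesis by (simp add: powr_powr flip: powr_numeral)
qed simp

lemma norm_cis_minus_real: "norm (a *\<^sub>R cis t - of_real r) ^ 3 = (r\<^sup>2 + a\<^sup>2 - 2 * r * a * cos t) powr (3 / 2)"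
proof -
  let ?z = "a *\<^sub>R cis t - complex_of_real r"
  have "r\<^sup>2 + a\<^sup>2 - 2 * r * a * cos t = (a * cos t - r)\<^sup>2 + (a * sin t)\<^sup>2"
    by (simp add: power2_diff power_mult_distrib cos_squared_eq) (simp add: algebra_simps)
  also have "\<dots> = (norm ?z)\<^sup>2"
    by (simp add: cmod_power2)
  also have "\<dots> powr (3 / 2) = norm ?z ^ 3"
    by (rule square_powr_three_halves) simp
  finally show ?thesis by simp
qed

text \<open>
  When a set of angles is invariant under reflection in the real axis, the imaginary parts of the
  attractions on a point of that axis cancel in pairs.
\<close>

lemma attraction_symmetric_ring:
  assumes "bij_betw \<sigma> K K" and "\<And>k. k \<in> K \<Longrightarrow> t (\<sigma> k) = 2 * pi - t k"
  shows "(\<Sum>k\<in>K. attraction (a *\<^sub>R cis (t k) - of_real r))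
    = of_real (\<Sum>k\<in>K. (a * cos (t k) - r) / (r\<^sup>2 + a\<^sup>2 - 2 * r * a * cos (t k)) powr (3 / 2))"
proof -
  let ?d = "\<lambda>k. (r\<^sup>2 + a\<^sup>2 - 2 * r * a * cos (t k)) powr (3 / 2)"
  let ?s = "\<lambda>k. a * sin (t k) / ?d k"
  have "(\<Sum>k\<in>K. ?s k) = (\<Sum>k\<in>K. ?s (\<sigma> k))"
    using sum.reindex_bij_betw[OF assms(1), of ?s] by simp
  also have "\<dots> = - (\<Sum>k\<in>K. ?s k)"
    unfolding sum_negf[symmetric] by (rule sum.cong) (simp_all add: assms(2))
  finally have cancel: "(\<Sum>k\<in>K. ?s k) = 0" by simp
  have summand: "attraction (a *\<^sub>R cis (t k) - of_real r) = Complex ((a * cos (t k) - r) / ?d k) (?s k)" for k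
  proof -
    have "z /\<^sub>R d = Complex (Re z / d) (Im z / d)" for z d
      by (simp add: complex_eq_iff divide_inverse_commute)
    then show ?thesis unfolding attraction_def norm_cis_minus_real by simp
  qed
  show ?thesis
    by (rule complex_eqI)
      (simp_all only: Re_sum Im_sum summand complex.sel cancel Re_complex_of_real Im_complex_of_real)
qed

lemma ring_self_attraction:
  assumes "0 < n"
  shows "(\<Sum>k<n. attraction (cis (2 * pi * real k / real n) - 1)) = - of_real (crown_S n)"
proof -
  let ?t = "\<lambda>k. 2 * pi * real k / real n"
  have "(\<Sum>k<n. attraction (cis (?t k) - 1)) = (\<Sum>k\<in>{1..n-1}. attraction (1 *\<^sub>R cis (?t k) - of_real 1))"
    by (rule sum.mono_neutral_cong_right) (auto simp: not_le)
  also have "\<dots> = of_real (\<Sum>k\<in>{1..n-1}. (1 * cos (?t k) - 1) / (1\<^sup>2 + 1\<^sup>2 - 2 * 1 * 1 * cos (?t k)) powr (3 / 2))"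
  proof (rule attraction_symmetric_ring)
    show "bij_betw (\<lambda>k. n - k) {1..n-1} {1..n-1}"
      by (rule bij_betw_byWitness[where f' = "\<lambda>k. n - k"]) auto
    show "?t (n - k) = 2 * pi - ?t k" if "k \<in> {1..n-1}" for k
    proof -
      have "real (n - k) = real n - real k" using that by (intro of_nat_diff) auto
      then show ?thesis using assms by (simp add: field_simps)
    qed
  qed
  also have "(\<Sum>k\<in>{1..n-1}. (1 * cos (?t k) - 1) / (1\<^sup>2 + 1\<^sup>2 - 2 * 1 * 1 * cos (?t k)) powr (3 / 2))
      = - crown_S n"
    unfolding crown_S_def sum_distrib_left sum_negf[symmetric]
  proof (rule sum.cong)
    fix k assume k: "k \<in> {1..n-1}"
    \<comment> \<open>The half-angle formula: the chord from \<open>1\<close> to \<open>cis (2 * u)\<close> has length \<open>2 * sin u\<close>.\<close>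
    define u where "u = real k * pi / real n"
    have "0 < u" "u < pi" using k assms by (auto simp: u_def field_simps)
    then have s: "0 < sin u" by (simp add: sin_gt_zero)
    have c: "cos (?t k) = 1 - 2 * (sin u)\<^sup>2"
      using cos_double_sin[of u] by (simp add: u_def field_simps)
    have "(2 * sin u)\<^sup>2 powr (3 / 2) = (2 * sin u) ^ 3"
      using s by (intro square_powr_three_halves) simp
    moreover have "1\<^sup>2 + 1\<^sup>2 - 2 * 1 * 1 * cos (?t k) = (2 * sin u)\<^sup>2"
      by (simp add: c power_mult_distrib)
    ultimately have d: "(1\<^sup>2 + 1\<^sup>2 - 2 * 1 * 1 * cos (?t k)) powr (3 / 2) = (2 * sin u) ^ 3"
      by simp
    show "(1 * cos (?t k) - 1) / (1\<^sup>2 + 1\<^sup>2 - 2 * 1 * 1 * cos (?t k)) powr (3 / 2)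
        = - (1 / 4 * (1 / sin (real k * pi / real n)))"
      unfolding d unfolding c u_def[symmetric] using s by (simp add: field_simps power2_eq_square power3_eq_cube)
  qed simp
  finally show ?thesis by simp
qed

lemma ring_cross_attraction:
  assumes "0 < n"
  shows "(\<Sum>k<n. attraction (a *\<^sub>R cis (crown_theta n (Suc k)) - of_real r))
    = of_real (\<Sum>k=1..n. (a * cos (crown_theta n k) - r)
        / (r\<^sup>2 + a\<^sup>2 - 2 * r * a * cos (crown_theta n k)) powr (3 / 2))"
proof -
  have "(\<Sum>k<n. attraction (a *\<^sub>R cis (crown_theta n (Suc k)) - of_real r))
      = (\<Sum>k=1..n. attraction (a *\<^sub>R cis (crown_theta n k) - of_real r))"
    by (simp add: sum.atLeast1_atMost_eq)
  also have "\<dots> = of_real (\<Sum>k=1..n. (a * cos (crown_theta n k) - r)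
        / (r\<^sup>2 + a\<^sup>2 - 2 * r * a * cos (crown_theta n k)) powr (3 / 2))"
  proof (rule attraction_symmetric_ring)
    show "bij_betw (\<lambda>k. Suc n - k) {1..n} {1..n}"
      by (rule bij_betw_byWitness[where f' = "\<lambda>k. Suc n - k"]) auto
    show "crown_theta n (Suc n - k) = 2 * pi - crown_theta n k" if "k \<in> {1..n}" for k
      using that assms by (simp add: crown_theta_def of_nat_diff field_simps)
  qed
  finally show ?thesis .
qed

section \<open>The equation of a twisted crown\<close>

text \<open>
  Rotating the crown so that the attracted body comes to lie on the positive real axis only permutes the
  summands of each ring. For an inner body this gives the \<open>k\<close>-sums at the angles
  \<open>2 * pi * k / n\<close> and \<open>crown_theta n k\<close>; for an outer body it is the same up to scaling by \<open>a\<close>.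
\<close>

lemma crown_total_attraction:
  assumes "0 < n" and "0 < a" and "i < n"
  shows "(\<Sum>j<2 * n. crown_mass n m j *\<^sub>R attraction (crown_position n a j - crown_position n a i))
      = - (crown_S n + m * crown_C12 n a) *\<^sub>R crown_position n a i" (is ?inner)
    and "(\<Sum>j<2 * n. crown_mass n m j *\<^sub>R attraction (crown_position n a j - crown_position n a (n + i)))
      = - ((m * crown_S n / a\<^sup>2 + crown_C21 n a) / a) *\<^sub>R crown_position n a (n + i)" (is ?outer)
proof -
  define P where "P k = cis (2 * pi * real k / real n)" for k
  define Q where "Q k = a *\<^sub>R cis (pi / real n + 2 * pi * real k / real n)" for k
  define w where "w = cis (pi / real n)"
  have pos: "crown_position n a k = P k" "crown_position n a (n + k) = Q k" if "k < n" for k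
    using that by (auto simp: crown_position_def P_def Q_def scaleR_conv_of_real)
  have split: "(\<Sum>j<2 * n. crown_mass n m j *\<^sub>R attraction (crown_position n a j - z))
      = (\<Sum>k<n. attraction (P k - z)) + m *\<^sub>R (\<Sum>k<n. attraction (Q k - z))" for z
  proof -
    let ?h = "\<lambda>j. crown_mass n m j *\<^sub>R attraction (crown_position n a j - z)"
    have "(\<Sum>j<2 * n. ?h j) = (\<Sum>j<n. ?h j) + (\<Sum>j=n..<n + n. ?h j)"
      unfolding mult_2 lessThan_atLeast0 by (rule sum.atLeastLessThan_concat[symmetric]) auto
    also have "(\<Sum>j=n..<n + n. ?h j) = (\<Sum>k<n. ?h (n + k))"
      using sum.shift_bounds_nat_ivl[of ?h 0 n n]
      by (simp add: atLeast0LessThan add.commute)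
    also have "(\<Sum>j<n. ?h j) = (\<Sum>k<n. attraction (P k - z))"
      by (rule sum.cong) (simp_all add: pos crown_mass_def)
    also have "(\<Sum>k<n. ?h (n + k)) = (\<Sum>k<n. m *\<^sub>R attraction (Q k - z))"
      by (rule sum.cong) (simp_all add: pos crown_mass_def)
    finally show ?thesis by (simp only: scaleR_right.sum)
  qed
  have period: "P (k + n) = P k" "Q (k + n) = Q k" for k
    using cis_ring_period[OF assms(1), of 0 k] cis_ring_period[OF assms(1), of "pi / real n" k]
    by (simp_all add: P_def Q_def)
  have theta: "cis (crown_theta n (Suc k)) = w * P k" for k
    by (simp add: crown_theta_def w_def P_def cis_mult) (simp add: field_simps add_divide_distrib)
  have P_add: "P (k + i) = P k * P i" for k
    by (simp add: P_def cis_mult add_divide_distrib distrib_left)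
  have Q: "Q k = a *\<^sub>R (w * P k)" for k
    by (simp add: Q_def w_def P_def cis_mult)
  have rot: "attraction (P i * z) = P i * attraction z" "attraction (w * z) = w * attraction z" for z
    unfolding P_def w_def by (rule attraction_cis_mult)+
  have self: "(\<Sum>k<n. attraction (P k - 1)) = - of_real (crown_S n)"
    unfolding P_def by (rule ring_self_attraction[OF assms(1)])

  have "(\<Sum>k<n. attraction (P k - P i)) = (\<Sum>k<n. attraction (P (k + i) - P i))"
    by (rule sum_periodic_shift) (simp add: period)
  also have "\<dots> = P i * (\<Sum>k<n. attraction (P k - 1))"
    unfolding sum_distrib_left rot[symmetric] by (simp add: P_add algebra_simps)
  finally have PP: "(\<Sum>k<n. attraction (P k - P i)) = - of_real (crown_S n) * P i"
    by (simp add: self)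

  have "(\<Sum>k<n. attraction (Q k - P i)) = (\<Sum>k<n. attraction (Q (k + i) - P i))"
    by (rule sum_periodic_shift) (simp add: period)
  also have "\<dots> = P i * (\<Sum>k<n. attraction (a *\<^sub>R cis (crown_theta n (Suc k)) - of_real 1))"
    unfolding sum_distrib_left rot[symmetric] theta by (simp add: Q P_add algebra_simps)
  also have "(\<Sum>k<n. attraction (a *\<^sub>R cis (crown_theta n (Suc k)) - of_real 1)) = - of_real (crown_C12 n a)"
    unfolding ring_cross_attraction[OF assms(1)] crown_C12_def of_real_minus[symmetric] sum_negf[symmetric]
    by (rule arg_cong[where f = of_real]) (rule sum.cong; simp add: minus_divide_left)
  finally have QP: "(\<Sum>k<n. attraction (Q k - P i)) = - of_real (crown_C12 n a) * P i"
    by simp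

  have "(\<Sum>k<n. attraction (Q k - Q i)) = (\<Sum>k<n. attraction (Q (k + i) - Q i))"
    by (rule sum_periodic_shift) (simp add: period)
  also have "\<dots> = (w * P i) * ((\<Sum>k<n. attraction (P k - 1)) /\<^sub>R a\<^sup>2)"
  proof -
    have "attraction (Q (k + i) - Q i) = w * (P i * (attraction (P k - 1) /\<^sub>R a\<^sup>2))" for k
    proof -
      have "Q (k + i) - Q i = w * (P i * (a *\<^sub>R (P k - 1)))"
        unfolding Q P_add by (simp add: algebra_simps)
      then show ?thesis by (simp only: rot attraction_scaleR[OF assms(2)])
    qed
    then show ?thesis by (simp add: sum_distrib_left scaleR_right.sum mult.assoc)
  qed
  finally have QQ: "(\<Sum>k<n. attraction (Q k - Q i)) = - of_real (crown_S n / a\<^sup>2) * (w * P i)"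
    by (simp add: self scaleR_conv_of_real field_simps)

  \<comment> \<open>Seen from an outer body, inner body \<open>k + i\<close> has angle \<open>(2 * k - 1) * pi / n\<close>; shifting the
    index by \<open>i + 1\<close> instead of \<open>i\<close> makes the angles run through \<open>crown_theta n 1\<close> to
    \<open>crown_theta n n\<close>.\<close>
  have "(\<Sum>k<n. attraction (P k - Q i)) = (\<Sum>k<n. attraction (P (k + Suc i) - Q i))"
    by (rule sum_periodic_shift) (simp add: period)
  also have "\<dots> = (w * P i) * (\<Sum>k<n. attraction (1 *\<^sub>R cis (crown_theta n (Suc k)) - of_real a))"
  proof -
    have "attraction (P (k + Suc i) - Q i)
        = w * (P i * attraction (1 *\<^sub>R cis (crown_theta n (Suc k)) - of_real a))" for k
    proof -
      have "P (k + Suc i) = w * w * P k * P i"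
        using P_add[of "Suc k"]
        by (simp add: P_def w_def cis_mult) (simp add: field_simps add_divide_distrib)
      then have "P (k + Suc i) - Q i = w * (P i * (1 *\<^sub>R cis (crown_theta n (Suc k)) - of_real a))"
        by (simp add: Q theta scaleR_conv_of_real algebra_simps)
      then show ?thesis by (simp only: rot)
    qed
    then show ?thesis by (simp add: sum_distrib_left mult.assoc)
  qed
  also have "(\<Sum>k<n. attraction (1 *\<^sub>R cis (crown_theta n (Suc k)) - of_real a)) = - of_real (crown_C21 n a)"
    unfolding ring_cross_attraction[OF assms(1)] crown_C21_def of_real_minus[symmetric] sum_negf[symmetric]
    by (rule arg_cong[where f = of_real]) (rule sum.cong; simp add: minus_divide_left add.commute)
  finally have PQ: "(\<Sum>k<n. attraction (P k - Q i)) = - of_real (crown_C21 n a) * (w * P i)"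
    by simp

  show ?inner
    unfolding pos[OF assms(3)] split PP QP
    by (simp add: scaleR_conv_of_real algebra_simps)
  show ?outer
    unfolding pos[OF assms(3)] split PQ QQ unfolding Q using assms(2)
    by (simp add: scaleR_conv_of_real field_simps)
qed

text \<open>
  The rays of the crown have the angles \<open>pi * e / n\<close> for \<open>0 \<le> e < 2 * n\<close>, even \<open>e\<close> on the inner ring
  and odd \<open>e\<close> on the other. As \<open>a > 0\<close>, different bodies lie on different rays, even if \<open>a = 1\<close>.
\<close>

lemma inj_on_crown_position:
  assumes "0 < n" and "0 < a"
  shows "inj_on (crown_position n a) {..<2 * n}"
proof -
  define r where "r j = (if j < n then 1 else a)" for j
  define e where "e j = (if j < n then 2 * j else 2 * (j - n) + 1)" for j
  have pos: "crown_position n a j = of_real (r j) * cis (pi * real (e j) / real n)" for j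
  proof -
    have "pi * (2 * x + 1) / real n = pi / real n + 2 * pi * x / real n" for x
      by (simp add: add_divide_distrib distrib_left)
    from this[of "real (j - n)"] show ?thesis
      by (simp add: crown_position_def r_def e_def mult_ac add.commute del: of_nat_diff)
  qed
  have r: "0 < r j" for j using assms by (simp add: r_def)
  show ?thesis
  proof (rule inj_onI)
    fix j k assume j: "j \<in> {..<2 * n}" and k: "k \<in> {..<2 * n}"
      and eq: "crown_position n a j = crown_position n a k"
    have "norm (crown_position n a j) = norm (crown_position n a k)" using eq by simp
    then have "r j = r k" using r[of j] r[of k] by (simp add: pos norm_mult)
    then have cis: "cis (pi * real (e j) / real n) = cis (pi * real (e k) / real n)"
      using eq r[of j] r[of k] by (simp add: pos)
    have e: "e l < 2 * n" if "l \<in> {..<2 * n}" for l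
      using that by (auto simp: e_def)
    have bound: "0 \<le> pi * real (e l) / real n \<and> pi * real (e l) / real n < 2 * pi"
      if "l \<in> {..<2 * n}" for l
    proof -
      have "real (e l) < 2 * real n" using e[OF that] by linarith
      then show ?thesis using assms(1) by (simp add: field_simps)
    qed
    have "Arg2pi (cis (pi * real (e l) / real n)) = pi * real (e l) / real n"
      if "l \<in> {..<2 * n}" for l
      by (rule Arg2pi_unique[of 1]) (use bound[OF that] in \<open>simp_all add: cis_conv_exp\<close>)
    then have "pi * real (e j) / real n = pi * real (e k) / real n"
      using j k cis by metis
    then have "e j = e k" using assms(1) by simp
    then show "j = k" using j k by (auto simp: e_def split: if_splits) presburger+
  qed
qed

lemma twisted_crown_iff:
  assumes "0 < n" and "0 < a" and "m \<noteq> 0"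
  shows "twisted_crown n a m \<longleftrightarrow> m * crown_G n a = a\<^sup>2 * crown_F n a"
proof -
  let ?A = "\<lambda>i. \<Sum>j<2 * n. crown_mass n m j *\<^sub>R attraction (crown_position n a j - crown_position n a i)"
  define x where "x = crown_S n + m * crown_C12 n a"
  define y where "y = (m * crown_S n / a\<^sup>2 + crown_C21 n a) / a"
  have nz: "crown_position n a i \<noteq> 0" for i
    using assms(2) by (simp add: crown_position_def)
  have inner: "?A i = - l *\<^sub>R crown_position n a i \<longleftrightarrow> l = x" if "i < n" for i l
    unfolding crown_total_attraction(1)[OF assms(1,2) that] x_def[symmetric] scaleR_cancel_right
    using nz by auto
  have outer: "?A (n + i) = - l *\<^sub>R crown_position n a (n + i) \<longleftrightarrow> l = y" if "i < n" for i l
    unfolding crown_total_attraction(2)[OF assms(1,2) that] y_def[symmetric] scaleR_cancel_right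
    using nz by auto
  have "(\<forall>i<2 * n. ?A i = - l *\<^sub>R crown_position n a i) \<longleftrightarrow> l = x \<and> l = y" for l
  proof
    assume all: "\<forall>i<2 * n. ?A i = - l *\<^sub>R crown_position n a i"
    then show "l = x \<and> l = y"
      using inner[of 0 l] outer[of 0 l] assms(1) by simp
  next
    assume l: "l = x \<and> l = y"
    show "\<forall>i<2 * n. ?A i = - l *\<^sub>R crown_position n a i"
    proof (intro allI impI)
      fix i assume "i < 2 * n"
      then consider "i < n" | k where "k < n" "i = n + k"
        by (metis add_diff_inverse_nat less_diff_conv2 mult_2 nat_add_left_cancel_less)
      then show "?A i = - l *\<^sub>R crown_position n a i"
        using l inner outer by cases blast+
    qed
  qed
  then have "twisted_crown n a m \<longleftrightarrow> x = y"
    unfolding twisted_crown_def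
    using inj_on_crown_position[OF assms(1,2)] assms(3)
    by (subst central_configuration_iff) (auto simp: crown_mass_def)
  also have "\<dots> \<longleftrightarrow> m * crown_G n a = a\<^sup>2 * crown_F n a"
    using assms(2)
    by (simp add: x_def y_def crown_F_def crown_G_def field_simps power2_eq_square power3_eq_cube) argo
  finally show ?thesis .
qed

text \<open>
  Scaling a crown by \<open>1/a\<close> and exchanging its rings gives the crown of radius \<open>1/a\<close>. Under this
  symmetry \<open>C12(a)\<close> becomes \<open>C21(1/a) / a\<^sup>2\<close>.
\<close>

lemma crown_G_eq_F_inverse:
  assumes "0 < a"
  shows "crown_G n a = a * crown_F n (1 / a)"
proof -
  have "crown_C21 n (1 / a) = a\<^sup>2 * crown_C12 n a"
    unfolding crown_C21_def crown_C12_def sum_distrib_left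
  proof (rule sum.cong)
    fix k
    define c where "c = cos (crown_theta n k)"
    have "1 + (1 / a)\<^sup>2 - 2 * (1 / a) * c = (1 + a\<^sup>2 - 2 * a * c) / a\<^sup>2"
      using assms by (simp add: field_simps power2_eq_square)
    moreover have "0 \<le> 1 + a\<^sup>2 - 2 * a * c"
    proof -
      have "1 + a\<^sup>2 - 2 * a * c = (1 - a)\<^sup>2 + 2 * a * (1 - c)"
        by (simp add: power2_eq_square algebra_simps)
      then show ?thesis using assms by (simp add: c_def)
    qed
    moreover have "(a\<^sup>2) powr (3 / 2) = a ^ 3"
      using assms by (simp add: square_powr_three_halves)
    ultimately have denom: "(1 + (1 / a)\<^sup>2 - 2 * (1 / a) * c) powr (3 / 2)
        = (1 + a\<^sup>2 - 2 * a * c) powr (3 / 2) / a ^ 3"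
      by (simp add: powr_divide)
    have "(1 / a - c) * a ^ 3 = a\<^sup>2 * (1 - a * c)"
      using assms by (simp add: field_simps power2_eq_square power3_eq_cube)
    then show "(1 / a - cos (crown_theta n k)) /
          (1 + (1 / a)\<^sup>2 - 2 * (1 / a) * cos (crown_theta n k)) powr (3 / 2) =
         a\<^sup>2 * ((1 - a * cos (crown_theta n k)) /
          (1 + a\<^sup>2 - 2 * a * cos (crown_theta n k)) powr (3 / 2))"
      unfolding c_def[symmetric] denom by simp
  qed simp
  then show ?thesis
    using assms by (simp add: crown_F_def crown_G_def field_simps power2_eq_square power3_eq_cube)
qed

section \<open>Two triangles\<close>

lemma crown_F_3:
  assumes "0 < a"
  shows "crown_F 3 a = a / sqrt 3 - (2 * a - 1) / (1 - a + a\<^sup>2) powr (3 / 2) - 1 / (1 + a)\<^sup>2"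
proof -
  have S: "crown_S 3 = 1 / sqrt 3"
  proof -
    have sin120: "sin (2 * pi / 3) = sqrt 3 / 2"
      using sin_120 by simp
    have "{1..3 - 1} = {1, 2::nat}" by auto
    then show ?thesis by (simp add: crown_S_def sin_60 sin120)
  qed
  have cos: "cos (crown_theta 3 1) = 1 / 2" "cos (crown_theta 3 2) = - 1" "cos (crown_theta 3 3) = 1 / 2"
  proof -
    have "crown_theta 3 3 = 2 * pi - pi / 3" by (simp add: crown_theta_def)
    then show "cos (crown_theta 3 3) = 1 / 2" by (simp only: cos_2pi_minus cos_60)
  qed (simp_all add: crown_theta_def cos_60)
  have sum3: "(\<Sum>k=1..3. f k) = f 1 + f 2 + f 3" for f :: "nat \<Rightarrow> real"
    by (simp add: numeral_3_eq_3 numeral_2_eq_2)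
  have near: "1 + a\<^sup>2 - 2 * a * (1 / 2) = 1 - a + a\<^sup>2" and far: "1 + a\<^sup>2 - 2 * a * (- 1) = (1 + a)\<^sup>2"
    by (simp_all add: power2_eq_square algebra_simps)
  have far_term: "(a - - 1) / (1 + a)\<^sup>2 powr (3 / 2) = 1 / (1 + a)\<^sup>2"
  proof -
    have "x / x ^ 3 = 1 / x\<^sup>2" if "0 < x" for x :: real
      using that by (simp add: field_simps power2_eq_square power3_eq_cube)
    from this[of "1 + a"] show ?thesis
      using assms by (simp add: square_powr_three_halves add.commute)
  qed
  have "crown_C21 3 a = (2 * a - 1) / (1 - a + a\<^sup>2) powr (3 / 2) + 1 / (1 + a)\<^sup>2"
    unfolding crown_C21_def sum3 cos near far far_term by (simp add: diff_divide_distrib)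
  then show ?thesis by (simp add: crown_F_def S)
qed

lemma continuous_on_crown_F_3: "continuous_on {0<..} (crown_F 3)"
proof -
  have "0 < 1 - a + a\<^sup>2" for a :: real
  proof -
    have "1 - a + a\<^sup>2 = (a - 1 / 2)\<^sup>2 + 3 / 4" by (simp add: power2_eq_square algebra_simps)
    then show ?thesis by (smt (verit) zero_le_power2 divide_pos_pos)
  qed
  then have "continuous_on {0<..}
      (\<lambda>a. a / sqrt 3 - (2 * a - 1) / (1 - a + a\<^sup>2) powr (3 / 2) - 1 / (1 + a)\<^sup>2 :: real)"
    by (intro continuous_intros) (auto simp: less_imp_neq[symmetric])
  then show ?thesis
    by (rule continuous_on_cong[THEN iffD2, rotated -1]) (simp_all add: crown_F_3)
qed

text \<open>
  The four points are chosen for being easy to evaluate while confining the two sign changes to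
  \<open>{1/4<..<1/2}\<close> and \<open>{1<..<2}\<close>; the product of the upper ends of these intervals is \<open>1\<close>.
\<close>

lemma crown_F_3_signs:
  "0 < crown_F 3 (1 / 4)" "crown_F 3 (1 / 2) < 0" "crown_F 3 1 < 0" "0 < crown_F 3 2"
proof -
  have s: "17 / 10 < sqrt 3" "sqrt 3 < 7 / 4"
    by (rule real_less_rsqrt real_less_lsqrt; simp add: power2_eq_square)+
  \<comment> \<open>At \<open>1/4\<close> the crude bound \<open>p \<le> 1\<close> is enough, since \<open>1/7 + 1/2 > 16/25\<close>.\<close>
  define p where "p = (13 / 16 :: real) powr (3 / 2)"
  have "0 < p" "p \<le> 1" unfolding p_def by (simp, rule powr_le1) auto
  then have "1 / 2 \<le> (1 / 2) / p" by (simp add: field_simps)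
  moreover have "1 / 7 < (1 / 4) / sqrt 3" using s by (simp add: field_simps)
  moreover have "crown_F 3 (1 / 4) = (1 / 4) / sqrt 3 + (1 / 2) / p - 16 / 25"
    by (simp add: crown_F_3 p_def power2_eq_square)
  ultimately show "0 < crown_F 3 (1 / 4)" by linarith
  show "crown_F 3 (1 / 2) < 0" "crown_F 3 1 < 0"
    using s by (simp_all add: crown_F_3 field_simps power2_eq_square)
  have "3 powr (3 / 2) = 3 * sqrt (3::real)"
    using powr_add[of "3::real" 1 "1 / 2"] by (simp add: powr_half_sqrt)
  then show "0 < crown_F 3 2"
    using s by (simp add: crown_F_3 field_simps power2_eq_square)
qed

lemma same_sign_if_no_zero:
  fixes f :: "real \<Rightarrow> real"
  assumes "continuous_on I f" and "is_interval I" and "\<And>x. x \<in> I \<Longrightarrow> f x \<noteq> 0"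
    and "x \<in> I" and "y \<in> I"
  shows "0 < f x \<longleftrightarrow> 0 < f y"
proof -
  have "connected (f ` I)"
    using assms(1,2) by (simp add: connected_continuous_image is_interval_connected)
  then have iv: "is_interval (f ` I)" by (simp add: is_interval_connected_1)
  have "0 < f v" if "u \<in> I" "v \<in> I" "0 < f u" for u v
  proof (rule ccontr)
    assume "\<not> 0 < f v"
    then have "0 \<in> f ` I"
      using iv that unfolding is_interval_1 by (meson imageI less_imp_le not_less)
    then show False using assms(3) by auto
  qed
  then show ?thesis using assms(4,5) by blast
qed

theorem theorem1:
  fixes z1 z2 :: real
  assumes "z1 < z2"
    and "{a. 0 < a \<and> crown_F 3 a = 0} = {z1, z2}"
  shows "admissible_values 3 = {0<..<z1} \<union> {1 / z2<..<z2} \<union> {1 / z1<..}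
    \<and> (\<forall>m>0. \<exists>a\<in>admissible_values 3. crown_H 3 a = m)"
proof -
  let ?F = "crown_F 3" and ?G = "crown_G 3"
  have zero_iff: "?F a = 0 \<longleftrightarrow> a = z1 \<or> a = z2" if "0 < a" for a
    using assms(2) that by blast
  have z: "0 < z1" "?F z1 = 0" "0 < z2" "?F z2 = 0" using assms(2) by blast+
  note cont = continuous_on_subset[OF continuous_on_crown_F_3]

  \<comment> \<open>Sign changes locate one zero in each of two disjoint intervals, so these are \<open>z1\<close> and \<open>z2\<close>.\<close>
  obtain u where u: "1 / 4 < u" "u < 1 / 2" "?F u = 0"
  proof -
    have "\<exists>u\<ge>1 / 4. u \<le> 1 / 2 \<and> ?F u = 0"
      using crown_F_3_signs by (intro IVT2' cont) auto
    then show ?thesis using that crown_F_3_signs by (metis less_irrefl order_less_le)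
  qed
  obtain v where v: "1 < v" "v < 2" "?F v = 0"
  proof -
    have "\<exists>v\<ge>1. v \<le> 2 \<and> ?F v = 0"
      using crown_F_3_signs by (intro IVT' cont) auto
    then show ?thesis using that crown_F_3_signs by (metis less_irrefl order_less_le)
  qed
  have "u = z1" "v = z2" using u v zero_iff[of u] zero_iff[of v] assms(1) by auto
  with u v have z1: "1 / 4 < z1" "z1 < 1 / 2" and z2: "1 < z2" "z2 < 2" by auto

  have F_pos_iff: "0 < ?F a \<longleftrightarrow> a < z1 \<or> z2 < a" and F_neg_iff: "?F a < 0 \<longleftrightarrow> z1 < a \<and> a < z2"
    if "0 < a" for a
  proof -
    have left: "0 < ?F a" if "0 < a" "a < z1" for a
      using same_sign_if_no_zero[of "{0<..<z1}" ?F a "1 / 4"] zero_iff that z1 assms(1) crown_F_3_signs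
      by (force intro!: cont simp: is_interval_1)
    have middle: "\<not> 0 < ?F a" if "z1 < a" "a < z2" for a
      using same_sign_if_no_zero[of "{z1<..<z2}" ?F a 1] zero_iff that z z1 z2 crown_F_3_signs
      by (force intro!: cont simp: is_interval_1)
    have right: "0 < ?F a" if "z2 < a" for a
      using same_sign_if_no_zero[of "{z2<..}" ?F a 2] zero_iff that z z2 assms(1) crown_F_3_signs
      by (force intro!: cont simp: is_interval_1)
    show "0 < ?F a \<longleftrightarrow> a < z1 \<or> z2 < a" "?F a < 0 \<longleftrightarrow> z1 < a \<and> a < z2"
      using left[of a] middle[of a] right[of a] zero_iff[OF that] that assms(1)
      by (smt (verit))+
  qed
  have G_pos_iff: "0 < ?G a \<longleftrightarrow> a < 1 / z2 \<or> 1 / z1 < a"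
    and G_neg_iff: "?G a < 0 \<longleftrightarrow> 1 / z2 < a \<and> a < 1 / z1" if "0 < a" for a
  proof -
    have "0 < ?G a \<longleftrightarrow> 0 < ?F (1 / a)" "?G a < 0 \<longleftrightarrow> ?F (1 / a) < 0"
      using that by (simp_all add: crown_G_eq_F_inverse zero_less_mult_iff mult_less_0_iff)
    then show "0 < ?G a \<longleftrightarrow> a < 1 / z2 \<or> 1 / z1 < a" "?G a < 0 \<longleftrightarrow> 1 / z2 < a \<and> a < 1 / z1"
      using F_pos_iff[of "1 / a"] F_neg_iff[of "1 / a"] that z by (auto simp: field_simps)
  qed

  have order: "z1 < 1 / z2" "1 / z2 < 1" "z2 < 1 / z1"
  proof -
    have "z1 * z2 < 1 / 2 * 2" using z z1 z2 by (intro mult_strict_mono) auto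
    then show "z1 < 1 / z2" "z2 < 1 / z1" using z by (simp_all add: field_simps)
    show "1 / z2 < 1" using z2 by simp
  qed

  have adm: "a \<in> admissible_values 3 \<longleftrightarrow> 0 < ?F a \<and> 0 < ?G a \<or> ?F a < 0 \<and> ?G a < 0"
    if "0 < a" for a
  proof -
    have "a \<in> admissible_values 3 \<longleftrightarrow> (\<exists>m>0. m * ?G a = a\<^sup>2 * ?F a)"
      using that twisted_crown_iff[of 3 a] by (auto simp: admissible_values_def)
    also have "\<dots> \<longleftrightarrow> 0 < ?F a \<and> 0 < ?G a \<or> ?F a < 0 \<and> ?G a < 0"
    proof
      assume "\<exists>m>0. m * ?G a = a\<^sup>2 * ?F a"
      then obtain m where m: "0 < m" "m * ?G a = a\<^sup>2 * ?F a" by blast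
      \<comment> \<open>At a common zero every \<open>m\<close> would solve the equation; the order of the zeros excludes it.\<close>
      have "?F a \<noteq> 0 \<or> ?G a \<noteq> 0"
        using F_pos_iff[OF that] F_neg_iff[OF that] G_pos_iff[OF that] G_neg_iff[OF that] order z2
        by linarith
      moreover have "sgn (?G a) = sgn (?F a)"
        using arg_cong[OF m(2), of sgn] m(1) that by (simp add: sgn_mult)
      ultimately show "0 < ?F a \<and> 0 < ?G a \<or> ?F a < 0 \<and> ?G a < 0"
        by (auto simp: sgn_if split: if_splits)
    next
      assume "0 < ?F a \<and> 0 < ?G a \<or> ?F a < 0 \<and> ?G a < 0"
      then have "0 < a\<^sup>2 * ?F a / ?G a \<and> a\<^sup>2 * ?F a / ?G a * ?G a = a\<^sup>2 * ?F a"
        using that by (auto simp: zero_less_divide_iff zero_less_mult_iff mult_less_0_iff)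
      then show "\<exists>m>0. m * ?G a = a\<^sup>2 * ?F a" by blast
    qed
    finally show ?thesis .
  qed
  have set_eq: "admissible_values 3 = {0<..<z1} \<union> {1 / z2<..<z2} \<union> {1 / z1<..}"
  proof (rule set_eqI)
    fix a
    show "a \<in> admissible_values 3 \<longleftrightarrow> a \<in> {0<..<z1} \<union> {1 / z2<..<z2} \<union> {1 / z1<..}"
    proof (cases "0 < a")
      case True
      then show ?thesis
        unfolding adm[OF True] F_pos_iff[OF True] F_neg_iff[OF True] G_pos_iff[OF True] G_neg_iff[OF True]
        using order z2 by (simp only: Un_iff greaterThanLessThan_iff greaterThan_iff) (smt (verit) True)
    next
      case False
      moreover have "0 < 1 / z1" "0 < 1 / z2" using z by simp_all
      ultimately have "a < 1 / z1" "a < 1 / z2" by linarith+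
      with False show ?thesis by (auto simp: admissible_values_def)
    qed
  qed
  have "\<exists>a\<in>admissible_values 3. crown_H 3 a = m" if m: "0 < m" for m
  proof -
    \<comment> \<open>\<open>a * F(1/a)\<close> replaces \<open>G(a)\<close>, so that continuity of \<open>F\<close> suffices.\<close>
    define \<phi> where "\<phi> a = a\<^sup>2 * ?F a - m * (a * ?F (1 / a))" for a
    have inv: "0 < 1 / z2" using z by simp
    have "\<exists>a\<ge>1 / z2. a \<le> z2 \<and> \<phi> a = 0"
    proof (rule IVT')
      show "\<phi> (1 / z2) \<le> 0"
        using F_neg_iff[OF inv] order z z2 by (simp add: \<phi>_def mult_nonneg_nonpos)
      show "0 \<le> \<phi> z2"
        using F_neg_iff[OF inv] order z z2 m by (simp add: \<phi>_def mult_le_0_iff)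
      show "1 / z2 \<le> z2" using order z2 by linarith
      show "continuous_on {1 / z2..z2} \<phi>"
      proof -
        have pos: "0 < x" if "1 / z2 \<le> x" for x using inv that by linarith
        show ?thesis
          unfolding \<phi>_def
          by (intro continuous_intros cont continuous_on_compose2[OF continuous_on_crown_F_3])
            (use z in \<open>auto dest: pos\<close>)
      qed
    qed
    then obtain a where a: "1 / z2 \<le> a" "a \<le> z2" "\<phi> a = 0" by blast
    have "0 < a" using a inv by linarith
    have eq: "a\<^sup>2 * ?F a = m * ?G a"
      using a(3) \<open>0 < a\<close> by (simp add: \<phi>_def crown_G_eq_F_inverse)
    \<comment> \<open>The zero is interior: at either end exactly one of \<open>F\<close> and \<open>G\<close> vanishes.\<close>
    have G: "?G a < 0"
      using G_neg_iff[OF \<open>0 < a\<close>] G_pos_iff[OF \<open>0 < a\<close>] F_neg_iff[OF \<open>0 < a\<close>] a order eq z2 \<open>0 < a\<close> m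
      by (smt (verit) mult_eq_0_iff mult_pos_neg zero_less_power)
    moreover have "?F a < 0"
      using G eq m \<open>0 < a\<close> by (metis mult_less_0_iff mult_pos_neg not_less_iff_gr_or_eq zero_less_power)
    ultimately have "a \<in> admissible_values 3" using adm[OF \<open>0 < a\<close>] by blast
    moreover have "crown_H 3 a = m"
      using eq G by (simp add: crown_H_def field_simps)
    ultimately show ?thesis by blast
  qed
  with set_eq show ?thesis by blast
qed

end
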